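(* Let $\alpha > 0$ be a real number and let $f: \mathbb{Z}^+ \to \mathbb{Z}_{\ge 0}$ satisfy $f(n) = \Theta(n^\alpha)$. If $\alpha < 1$, then Arsonist has a winning strategy in the adversarial burning game in which Builder adds $f(n)$ vertices on turn $n$. If $\alpha \ge 1$, then Builder has a winning strategy in this game.
   Context: Adversarial burning game. Let $f:\mathbb{Z}^+\to\mathbb{Z}_{\ge 0}$ be a function known to both players, Builder and Arsonist. All graphs are finite and simple. The game starts with the empty graph $G_0$ (no vertices) and the empty set of burning vertices $B_0=\emptyset$. A vertex is either burning or unburned; burning vertices stay burning forever. At time step (turn) $n\ge 1$, in this order: (1) Builder adds $f(n)$ new (unburned) vertices to $G_{n-1}$, together with edges each of which is incident to at least one of these new vertices (joining two new vertices, or a new vertex and an old vertex), so that the resulting graph $G_n$ is connected (the graph with no vertices is allowed while no vertex has been added). Thus $G_{n-1}$ is the subgraph of $G_n$ induced by $V(G_{n-1})$. (2) The fire spreads: every vertex of $G_n$ adjacent in $G_n$ to a vertex of $B_{n-1}$ becomes burning. (3) Arsonist selects a fire source $v_n$, a vertex of $G_n$ that is still unburned, and it becomes burning; if $G_n$ has no unburned vertex, no fire source is selected at this step. Let $V_n=V(G_n)$ and let $B_n\subseteq V_n$ be the set of vertices burning at the end of step $n$. The game is played for all $n\in\mathbb{Z}^+$ with perfect information: each player's move may depend on the whole history of play so far. Writing $\mathbf{G}=(G_n)_{n\ge1}$ and $\mathbf{v}=(v_n)_{n\ge1}$, define $$\underline{\delta}(\mathbf{G},\mathbf{v})=\liminf_{n\to\infty}\frac{|B_n|}{|V_n|},\qquad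 \overline{\delta}(\mathbf{G},\mathbf{v})=\limsup_{n\to\infty}\frac{|B_n|}{|V_n|},$$ and $\delta(\mathbf{G},\mathbf{v})=\lim_{n\to\infty}|B_n|/|V_n|$ if this limit exists (only the $n$ with $V_n\neq\emptyset$ are considered). Arsonist wins if $\delta(\mathbf{G},\mathbf{v})$ exists and equals $1$. Builder wins if $\overline{\delta}(\mathbf{G},\mathbf{v})<1$. Otherwise (that is, $\overline{\delta}=1$ but $\underline{\delta}<1$) the game is a draw. A winning strategy for a player is a strategy which guarantees that this player wins whatever the other player does. Asymptotic notation (as $n\to\infty$): $f(n)=\Theta(g(n))$ means that there are constants $c_1,c_2>0$ and $n_0$ with $c_1 g(n)\le f(n)\le c_2 g(n)$ for all $n\ge n_0$. *)

theory Defs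
  imports
    "Graph_Theory.Digraph_Component"
    "HOL-Library.Extended_Real"
    "HOL-Library.Landau_Symbols"
begin

(* Finite simple graphs are the symmetric loop-free pair digraphs of Graph_Theory (locale
   pair_graph); an edge {u, v} is the pair of arcs (u, v), (v, u).  Vertices are natural numbers,
   so that there is always an unlimited supply of new vertices; the names of the new vertices
   are part of Builder's choice. *)
type_synonym vgraph = "nat pair_pre_digraph"

definition empty_vgraph :: vgraph where
  "empty_vgraph = \<lparr>pverts = {}, parcs = {}\<rparr>"

(* The library's connected graphs are nonempty, whereas here the graph without vertices is allowed.
   The name is qualified because of topological connectedness. *)
definition builder_move :: "nat \<Rightarrow> vgraph \<Rightarrow> vgraph \<Rightarrow> bool" where
  "builder_move k G G' \<longleftrightarrow>
     pair_graph G' \<and>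
     pverts G \<subseteq> pverts G' \<and> card (pverts G' - pverts G) = k \<and>
     parcs G \<subseteq> parcs G' \<and>
     (\<forall>(u, v) \<in> parcs G' - parcs G. u \<in> pverts G' - pverts G \<or> v \<in> pverts G' - pverts G) \<and>
     (pverts G' = {} \<or> Digraph_Component.connected (with_proj G'))"

definition spread :: "vgraph \<Rightarrow> nat set \<Rightarrow> nat set" where
  "spread G B = B \<union> {v \<in> pverts G. \<exists>u \<in> B. u \<rightarrow>\<^bsub>with_proj G\<^esub> v}"

(* B is the set of vertices burning when Arsonist is to move; None means that no source is chosen. *)
definition arsonist_move :: "vgraph \<Rightarrow> nat set \<Rightarrow> nat option \<Rightarrow> bool" where
  "arsonist_move G B s \<longleftrightarrow>
     (case s of None \<Rightarrow> pverts G \<subseteq> B | Some v \<Rightarrow> v \<in> pverts G - B)"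

(* A play is given by the graphs G n (with G 0 empty) and the sources s n chosen on turn n.
   Turns are numbered from 1, so s 0 and f 0 are never used. *)
fun burning :: "(nat \<Rightarrow> vgraph) \<Rightarrow> (nat \<Rightarrow> nat option) \<Rightarrow> nat \<Rightarrow> nat set" where
  "burning G s 0 = {}"
| "burning G s (Suc n) = spread (G (Suc n)) (burning G s n) \<union> set_option (s (Suc n))"

definition builder_legal :: "(nat \<Rightarrow> nat) \<Rightarrow> (nat \<Rightarrow> vgraph) \<Rightarrow> bool" where
  "builder_legal f G \<longleftrightarrow> (\<forall>n. builder_move (f (Suc n)) (G n) (G (Suc n)))"

definition arsonist_legal :: "(nat \<Rightarrow> vgraph) \<Rightarrow> (nat \<Rightarrow> nat option) \<Rightarrow> bool" where
  "arsonist_legal G s \<longleftrightarrow>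
     (\<forall>n. arsonist_move (G (Suc n)) (spread (G (Suc n)) (burning G s n)) (s (Suc n)))"

(* Turns with an empty graph contribute the value 0 / 0 = 0.  Since the vertex sets of a play
   increase, there are only finitely many such turns once some vertex is ever added, so they do not
   affect the limits below. *)
definition burning_ratio :: "(nat \<Rightarrow> vgraph) \<Rightarrow> (nat \<Rightarrow> nat option) \<Rightarrow> nat \<Rightarrow> real" where
  "burning_ratio G s n = real (card (burning G s n)) / real (card (pverts (G n)))"

definition upper_burning_density :: "(nat \<Rightarrow> vgraph) \<Rightarrow> (nat \<Rightarrow> nat option) \<Rightarrow> ereal" where
  "upper_burning_density G s = limsup (\<lambda>n. ereal (burning_ratio G s n))"

definition arsonist_wins :: "(nat \<Rightarrow> vgraph) \<Rightarrow> (nat \<Rightarrow> nat option) \<Rightarrow> bool" where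
  "arsonist_wins G s \<longleftrightarrow> burning_ratio G s \<longlonglongrightarrow> 1"

definition builder_wins :: "(nat \<Rightarrow> vgraph) \<Rightarrow> (nat \<Rightarrow> nat option) \<Rightarrow> bool" where
  "builder_wins G s \<longleftrightarrow> upper_burning_density G s < 1"

type_synonym history = "(vgraph \<times> nat option) list"

(* The moves of turns 1, ..., n. *)
definition history :: "(nat \<Rightarrow> vgraph) \<Rightarrow> (nat \<Rightarrow> nat option) \<Rightarrow> nat \<Rightarrow> history" where
  "history G s n = map (\<lambda>i. (G i, s i)) [1..<Suc n]"

type_synonym builder_strategy = "history \<Rightarrow> vgraph"

(* Arsonist also sees the graph that Builder has just produced. *)
type_synonym arsonist_strategy = "history \<Rightarrow> vgraph \<Rightarrow> nat option"

definition follows_builder ::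
    "builder_strategy \<Rightarrow> (nat \<Rightarrow> vgraph) \<Rightarrow> (nat \<Rightarrow> nat option) \<Rightarrow> bool" where
  "follows_builder \<sigma> G s \<longleftrightarrow> (\<forall>n. G (Suc n) = \<sigma> (history G s n))"

definition follows_arsonist ::
    "arsonist_strategy \<Rightarrow> (nat \<Rightarrow> vgraph) \<Rightarrow> (nat \<Rightarrow> nat option) \<Rightarrow> bool" where
  "follows_arsonist \<tau> G s \<longleftrightarrow> (\<forall>n. s (Suc n) = \<tau> (history G s n) (G (Suc n)))"

(* A winning strategy must itself only make legal moves, as long as the opponent does; both players
   have a legal move in every position, so the premises below are satisfiable for every strategy. *)
definition builder_has_winning_strategy :: "(nat \<Rightarrow> nat) \<Rightarrow> bool" where
  "builder_has_winning_strategy f \<longleftrightarrow>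
     (\<exists>\<sigma>. \<forall>G s. G 0 = empty_vgraph \<and> follows_builder \<sigma> G s \<and> arsonist_legal G s \<longrightarrow>
        builder_legal f G \<and> builder_wins G s)"

definition arsonist_has_winning_strategy :: "(nat \<Rightarrow> nat) \<Rightarrow> bool" where
  "arsonist_has_winning_strategy f \<longleftrightarrow>
     (\<exists>\<tau>. \<forall>G s. G 0 = empty_vgraph \<and> builder_legal f G \<and> follows_arsonist \<tau> G s \<longrightarrow>
        arsonist_legal G s \<and> arsonist_wins G s)"

end

theory Submission
  imports Defs "HOL-Real_Asymp.Real_Asymp"
begin

text \<open>After turn \<open>n\<close> the graph has \<open>N\<^sub>n = f 1 + \<dots> + f n\<close> vertices, which is of order \<open>n\<^sup>\<alpha>\<^sup>+\<^sup>1\<close>. The threshold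
  \<open>\<alpha> = 1\<close> is where this is of order \<open>n\<^sup>2\<close>, the number of vertices that \<open>n\<close> fires can burn on a path in \<open>n\<close> turns.

  For \<open>\<alpha> \<ge> 1\<close> Builder always prolongs one path at the same end. Even if the whole path burns at time \<open>n - k\<close>, only
  \<open>k + k\<^sup>2\<close> of the vertices added after it can burn by time \<open>n\<close>: the fire advances by \<open>k\<close> across the old end, and
  the sources lit since then burn \<open>1 + 3 + \<dots> + (2 k - 1)\<close> vertices (\<open>card_burning_path_le\<close>). At least a
  constant times \<open>k n\<close> vertices have been added, so if \<open>k\<close> is a small fraction of \<open>n\<close>, at least half of them do
  not burn, and these are a constant fraction of the graph (\<open>builder_wins_on_paths\<close>).

  For \<open>\<alpha> < 1\<close> Arsonist always lights an unburned vertex at maximal distance from the fire in the present graph.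
  As long as this distance exceeds \<open>2 r\<close>, the balls of radius \<open>r\<close> around the chosen sources are disjoint and have
  more than \<open>r\<close> vertices each; new edges may shorten distances, but this only enlarges the earlier balls. Hence,
  within any \<open>m\<close> turns with \<open>N < m (r + 1)\<close> at their end, there is one at which everything is within \<open>2 r\<close> of the
  fire (\<open>exists_turn_near_fire\<close>), and \<open>2 r\<close> turns later all of that graph burns. With \<open>r = m\<close> larger
  than the square root of \<open>N\<close> but small compared with \<open>n\<close>, at any late time only the vertices of the last \<open>3 m\<close> turns can be
  unburned, and their proportion tends to \<open>0\<close> (\<open>arsonist_wins\<close>).\<close>

section \<open>Growth of the number of vertices\<close>

definition vertex_count :: "(nat \<Rightarrow> nat) \<Rightarrow> nat \<Rightarrow> nat" where
  "vertex_count f n = (\<Sum>i = 1..n. f i)"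

lemma vertex_count_Suc [simp]: "vertex_count f (Suc n) = vertex_count f n + f (Suc n)"
  by (simp add: vertex_count_def)

lemma vertex_count_0 [simp]: "vertex_count f 0 = 0"
  by (simp add: vertex_count_def)

lemma vertex_count_mono: "m \<le> n \<Longrightarrow> vertex_count f m \<le> vertex_count f n"
  by (induction rule: dec_induct) auto

lemma vertex_count_diff_bounds:
  fixes c C \<alpha> :: real
  assumes "0 \<le> c" "0 \<le> C" "0 \<le> \<alpha>" "m \<le> n"
    and f: "\<And>i. m < i \<Longrightarrow> i \<le> n \<Longrightarrow> c * real i powr \<alpha> \<le> real (f i) \<and> real (f i) \<le> C * real i powr \<alpha>"
  shows "real (vertex_count f m) + c * real (n - m) * real m powr \<alpha> \<le> real (vertex_count f n)"
    and "real (vertex_count f n) \<le> real (vertex_count f m) + C * real (n - m) * real n powr \<alpha>"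
proof -
  have "(\<Sum>i\<in>{m<..n}. c * real m powr \<alpha>) \<le> (\<Sum>i\<in>{m<..n}. real (f i))"
  proof (rule sum_mono)
    fix i assume i: "i \<in> {m<..n}"
    have "c * real m powr \<alpha> \<le> c * real i powr \<alpha>"
      using i assms by (intro mult_left_mono powr_mono2) auto
    then show "c * real m powr \<alpha> \<le> real (f i)"
      using f[of i] i by simp
  qed
  moreover have "(\<Sum>i\<in>{m<..n}. real (f i)) \<le> (\<Sum>i\<in>{m<..n}. C * real n powr \<alpha>)"
  proof (rule sum_mono)
    fix i assume i: "i \<in> {m<..n}"
    have "C * real i powr \<alpha> \<le> C * real n powr \<alpha>"
      using i assms by (intro mult_left_mono powr_mono2) auto
    then show "real (f i) \<le> C * real n powr \<alpha>"
      using f[of i] i by simp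
  qed
  moreover have "vertex_count f n = vertex_count f m + (\<Sum>i\<in>{m<..n}. f i)"
  proof -
    have "{1..n} = {1..m} \<union> {m<..n}" using \<open>m \<le> n\<close> by auto
    then show ?thesis unfolding vertex_count_def by (simp add: sum.union_disjoint ivl_disj_int)
  qed
  ultimately show "real (vertex_count f m) + c * real (n - m) * real m powr \<alpha> \<le> real (vertex_count f n)"
    and "real (vertex_count f n) \<le> real (vertex_count f m) + C * real (n - m) * real n powr \<alpha>"
    by (simp_all add: mult_ac)
qed

text \<open>All that the two strategies need to know about \<open>f\<close>: the number of vertices added in the turns from \<open>m\<close> to
  \<open>n\<close> lies between constant multiples of \<open>(n - m) m\<^sup>\<alpha>\<close> and \<open>(n - m) n\<^sup>\<alpha>\<close>, and their total number is of order
  \<open>n\<^sup>\<alpha>\<^sup>+\<^sup>1\<close>. The lower bound on the total already comes from the second half of the turns, on which \<open>i\<^sup>\<alpha>\<close> is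
  comparable to \<open>n\<^sup>\<alpha>\<close>.\<close>
lemma vertex_count_growth:
  fixes \<alpha> :: real and f :: "nat \<Rightarrow> nat"
  assumes \<alpha>: "\<alpha> > 0" and f: "(\<lambda>n. real (f n)) \<in> \<Theta>(\<lambda>n. real n powr \<alpha>)"
  obtains c C d D :: real and n0 :: nat where
    "c > 0" "C > 0" "d > 0" "D > 0"
    "\<And>m n. n0 \<le> m \<Longrightarrow> m \<le> n \<Longrightarrow>
       real (vertex_count f m) + c * real (n - m) * real m powr \<alpha> \<le> real (vertex_count f n)"
    "\<And>m n. n0 \<le> m \<Longrightarrow> m \<le> n \<Longrightarrow>
       real (vertex_count f n) \<le> real (vertex_count f m) + C * real (n - m) * real n powr \<alpha>"
    "\<And>n. n0 \<le> n \<Longrightarrow> d * real n powr (\<alpha> + 1) \<le> real (vertex_count f n)"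
    "\<And>n. n0 \<le> n \<Longrightarrow> real (vertex_count f n) \<le> D * real n powr (\<alpha> + 1)"
proof -
  from f have "(\<lambda>n. real (f n)) \<in> O(\<lambda>n. real n powr \<alpha>)" "(\<lambda>n. real (f n)) \<in> \<Omega>(\<lambda>n. real n powr \<alpha>)"
    by (auto simp: bigtheta_def)
  then obtain c C where c: "c > 0" "C > 0"
    and ev: "\<forall>\<^sub>F n in at_top. norm (real (f n)) \<le> C * norm (real n powr \<alpha>)"
      "\<forall>\<^sub>F n in at_top. c * norm (real n powr \<alpha>) \<le> norm (real (f n))"
    by (elim landau_o.bigE landau_omega.bigE) blast
  from eventually_conj[OF ev] obtain n1
    where n1: "\<And>i. n1 \<le> i \<Longrightarrow> c * real i powr \<alpha> \<le> real (f i) \<and> real (f i) \<le> C * real i powr \<alpha>"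
    unfolding eventually_at_top_linorder by auto
  note bounds = vertex_count_diff_bounds[where f = f and c = c and C = C and \<alpha> = \<alpha>]
  have lower: "real (vertex_count f m) + c * real (n - m) * real m powr \<alpha> \<le> real (vertex_count f n)"
    if "n1 \<le> m" "m \<le> n" for m n
    using that c \<alpha> n1 by (intro bounds) auto
  have upper: "real (vertex_count f n) \<le> real (vertex_count f m) + C * real (n - m) * real n powr \<alpha>"
    if "n1 \<le> m" "m \<le> n" for m n
    using that c \<alpha> n1 by (intro bounds) auto
  \<comment> \<open>From \<open>n0\<close> on, the half \<open>n div 2\<close> is beyond \<open>n1\<close> and at least \<open>n / 4\<close>.\<close>
  define n0 where "n0 = 2 * n1 + 2"
  define d where "d = c / 2 / 4 powr \<alpha>"
  define D where "D = real (vertex_count f n1) + C"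
  show ?thesis
  proof (rule that[of c C d D n0])
    show "c > 0" "C > 0" "d > 0" "D > 0" using c by (auto simp: d_def D_def add_nonneg_pos)
  next
    fix n assume n: "n0 \<le> n"
    then have "n1 \<le> n div 2" "n div 2 \<le> n" by (auto simp: n0_def)
    from lower[OF this]
    have 1: "c * real (n - n div 2) * real (n div 2) powr \<alpha> \<le> real (vertex_count f n)"
      by (smt (verit) of_nat_0_le_iff)
    have "c * (real n / 2) * (real n / 4) powr \<alpha> \<le> c * real (n - n div 2) * real (n div 2) powr \<alpha>"
    proof (intro mult_mono powr_mono2)
      show "real n / 2 \<le> real (n - n div 2)" by linarith
      show "real n / 4 \<le> real (n div 2)" using n by (simp add: n0_def)
    qed (use c \<alpha> in auto)
    also have "c * (real n / 2) * (real n / 4) powr \<alpha> = d * real n powr (\<alpha> + 1)"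
      using n by (simp add: d_def powr_divide powr_add n0_def)
    finally show "d * real n powr (\<alpha> + 1) \<le> real (vertex_count f n)"
      using 1 by linarith
  next
    fix n assume n: "n0 \<le> n"
    then have n': "n1 \<le> n" "1 \<le> n" by (auto simp: n0_def)
    have "real (vertex_count f n) \<le> real (vertex_count f n1) + C * real (n - n1) * real n powr \<alpha>"
      using upper[of n1 n] n' by simp
    also have "\<dots> \<le> real (vertex_count f n1) * real n powr (\<alpha> + 1) + C * real n * real n powr \<alpha>"
    proof (intro add_mono mult_right_mono mult_left_mono)
      show "real (vertex_count f n1) \<le> real (vertex_count f n1) * real n powr (\<alpha> + 1)"
        using n' \<alpha> by (simp add: mult_le_cancel_left1 ge_one_powr_ge_zero)
    qed (use c in auto)
    also have "\<dots> = D * real n powr (\<alpha> + 1)"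
      using n' by (simp add: D_def powr_add algebra_simps)
    finally show "real (vertex_count f n) \<le> D * real n powr (\<alpha> + 1)" .
  next
    fix m n assume "n0 \<le> m" "m \<le> n"
    then show "real (vertex_count f m) + c * real (n - m) * real m powr \<alpha> \<le> real (vertex_count f n)"
      and "real (vertex_count f n) \<le> real (vertex_count f m) + C * real (n - m) * real n powr \<alpha>"
      using lower upper by (simp_all add: n0_def)
  qed
qed

section \<open>Builder extends a path\<close>

definition path_graph :: "nat \<Rightarrow> vgraph" where
  "path_graph N = \<lparr>pverts = {..<N}, parcs = {(u, v). u < N \<and> v < N \<and> (v = Suc u \<or> u = Suc v)}\<rparr>"

lemma pverts_path_graph [simp]: "pverts (path_graph N) = {..<N}"
  by (simp add: path_graph_def)

lemma parcs_path_graph: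
  "(u, v) \<in> parcs (path_graph N) \<longleftrightarrow> u < N \<and> v < N \<and> (v = Suc u \<or> u = Suc v)"
  by (simp add: path_graph_def)

lemma pair_graph_path_graph: "pair_graph (path_graph N)"
proof
  show "finite (parcs (path_graph N))"
    by (rule finite_subset[of _ "{..<N} \<times> {..<N}"]) (auto simp: path_graph_def)
  show "symmetric (with_proj (path_graph N))"
    by (auto simp: symmetric_def sym_def parcs_path_graph)
qed (auto simp: parcs_path_graph)

text \<open>The path on the first \<open>N\<close> numbers is an induced subgraph of every longer one, so prolonging it at its end
  is a legal move.\<close>
lemma builder_move_path_graph:
  assumes "N \<le> N'"
  shows "builder_move (N' - N) (path_graph N) (path_graph N')"
proof -
  interpret P: pair_graph "path_graph N'" by (rule pair_graph_path_graph)
  have step: "u \<rightarrow>\<^sup>*\<^bsub>with_proj (path_graph N')\<^esub> v" if "u \<le> v" "v < N'" for u v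
    using that
  proof (induction rule: dec_induct)
    case base
    then show ?case by (intro P.reachable_refl) auto
  next
    case (step w)
    then show ?case by (intro P.reachable_adj_trans[of u w "Suc w"]) (auto simp: parcs_path_graph)
  qed
  have "strongly_connected (with_proj (path_graph N'))" if "N' > 0"
  proof (rule strongly_connectedI)
    show "verts (path_graph N') \<noteq> {}" using that by (auto simp: lessThan_empty_iff)
    fix u v assume "u \<in> verts (path_graph N')" "v \<in> verts (path_graph N')"
    then show "u \<rightarrow>\<^sup>*\<^bsub>with_proj (path_graph N')\<^esub> v"
      using step[of u v] step[of v u] symmetric_reachable[OF P.pair_sym_arcs, of v u] by (cases u v rule: le_cases) auto
  qed
  then have "Digraph_Component.connected (with_proj (path_graph N'))" if "N' > 0"
    using that P.reachable_mk_symmetric_eq[OF P.pair_sym_arcs]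
    unfolding connected_def strongly_connected_def by simp
  then show ?thesis
    using assms pair_graph_path_graph[of N'] unfolding builder_move_def
    by (auto simp: parcs_path_graph card_Diff_subset lessThan_empty_iff)
qed

lemma burning_subset_pverts:
  assumes "arsonist_legal G s" and mono: "\<And>n. pverts (G n) \<subseteq> pverts (G (Suc n))"
  shows "burning G s n \<subseteq> pverts (G n)"
proof (induction n)
  case (Suc n)
  have "set_option (s (Suc n)) \<subseteq> pverts (G (Suc n))"
    using assms(1) unfolding arsonist_legal_def arsonist_move_def
    by (auto split: option.splits)
  with Suc mono[of n] show ?case by (auto simp: spread_def)
qed simp

text \<open>At worst every vertex present at time \<open>m\<close> burns at that time. From then on fire reaches the later part of
  the path only across its old end, one vertex per turn, or out of a source lit after time \<open>m\<close>, which has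
  covered a ball of radius \<open>n - j\<close> by time \<open>n\<close> if it was lit at time \<open>j\<close>. Truncated subtraction in the left
  end of the interval cuts the ball at the end \<open>0\<close> of the path. The bound uses that the path is only ever
  prolonged: no new vertex brings two old ones closer.\<close>
lemma burning_path_subset:
  assumes G: "\<And>n. G n = path_graph (N n)" and N: "mono N"
    and legal: "arsonist_legal G s" and "m \<le> n"
  shows "burning G s n \<subseteq> {..<N m + (n - m)} \<union>
           (\<Union>j\<in>{m<..n}. \<Union>v\<in>set_option (s j). {v - (n - j)..v + (n - j)})"
  using \<open>m \<le> n\<close>
proof (induction rule: dec_induct)
  case base
  show ?case
  proof -
    have "pverts (G n) \<subseteq> pverts (G (Suc n))" for n by (simp add: G monoD[OF N])
    from burning_subset_pverts[OF legal this, of m] have "burning G s m \<subseteq> {..<N m}" by (simp add: G[of m])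
    then show ?thesis by auto
  qed
next
  case (step n)
  show ?case
  proof
    fix w assume "w \<in> burning G s (Suc n)"
    then consider "s (Suc n) = Some w" | u where "u \<in> burning G s n" "w \<le> Suc u" "u \<le> Suc w"
      by (fastforce simp: spread_def G parcs_path_graph)
    then show "w \<in> {..<N m + (Suc n - m)} \<union>
        (\<Union>j\<in>{m<..Suc n}. \<Union>v\<in>set_option (s j). {v - (Suc n - j)..v + (Suc n - j)})"
    proof cases
      case 1
      then show ?thesis using step.hyps by force
    next
      case 2
      from 2(1) step.IH consider "u < N m + (n - m)"
        | j v where "m < j" "j \<le> n" "s j = Some v" "v - (n - j) \<le> u" "u \<le> v + (n - j)"
        by fastforce
      then show ?thesis
      proof cases
        case 1
        then have "w < N m + (Suc n - m)" using \<open>w \<le> Suc u\<close> step.hyps(1) by linarith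
        then show ?thesis by blast
      next
        case (2 j v)
        have "w \<in> {v - (Suc n - j)..v + (Suc n - j)}" using 2 \<open>w \<le> Suc u\<close> \<open>u \<le> Suc w\<close> by auto
        then show ?thesis using 2 by force
      qed
    qed
  qed
qed

text \<open>The square is the sum of the ball sizes \<open>1, 3, 5, \<dots>\<close>.\<close>
lemma card_burning_path_le:
  assumes "\<And>n. G n = path_graph (N n)" "mono N" "arsonist_legal G s" "m \<le> n"
  shows "card (burning G s n) \<le> N m + (n - m) + (n - m)\<^sup>2"
proof -
  have "card (burning G s n) \<le> card ({..<N m + (n - m)} \<union>
           (\<Union>j\<in>{m<..n}. \<Union>v\<in>set_option (s j). {v - (n - j)..v + (n - j)}))"
    by (intro card_mono burning_path_subset assms) auto
  also have "\<dots> \<le> card {..<N m + (n - m)} +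
      card (\<Union>j\<in>{m<..n}. \<Union>v\<in>set_option (s j). {v - (n - j)..v + (n - j)})"
    by (rule card_Un_le)
  also have "card (\<Union>j\<in>{m<..n}. \<Union>v\<in>set_option (s j). {v - (n - j)..v + (n - j)}) \<le>
      (\<Sum>j\<in>{m<..n}. card (\<Union>v\<in>set_option (s j). {v - (n - j)..v + (n - j)}))"
    by (rule card_UN_le) simp
  also have "\<dots> \<le> (\<Sum>j\<in>{m<..n}. 2 * (n - j) + 1)"
    by (rule sum_mono) (case_tac "s j"; auto)
  also have "\<dots> = (n - m)\<^sup>2"
    using \<open>m \<le> n\<close>
  proof (induction m rule: inc_induct)
    case (step m)
    have "{m<..n} = insert (Suc m) {Suc m<..n}" using step.hyps by auto
    then show ?case using step by (simp add: power2_eq_square) (simp add: algebra_simps Suc_diff_Suc[symmetric])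
  qed simp
  finally show ?thesis by simp
qed

text \<open>In the last \<open>k\<close> turns at most \<open>k + k\<^sup>2\<close> of the vertices added in these turns catch fire, while about
  \<open>k n\<^sup>\<alpha> \<ge> k n\<close> of them have been added. For \<open>k \<approx> \<delta> n\<close> with a small constant \<open>\<delta>\<close> the second number is
  larger, by a constant fraction of \<open>n\<^sup>\<alpha>\<^sup>+\<^sup>1\<close> and hence of all vertices.\<close>
lemma builder_wins_on_paths:
  fixes \<alpha> :: real and f :: "nat \<Rightarrow> nat"
  assumes \<alpha>: "\<alpha> \<ge> 1" and f: "(\<lambda>n. real (f n)) \<in> \<Theta>(\<lambda>n. real n powr \<alpha>)"
    and G: "\<And>n. G n = path_graph (vertex_count f n)" and legal: "arsonist_legal G s"
  shows "builder_wins G s"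
proof -
  obtain c C d D n0 where pos: "c > 0" "D > 0" "d > 0" and
    lower: "\<And>m n. n0 \<le> m \<Longrightarrow> m \<le> n \<Longrightarrow>
       real (vertex_count f m) + c * real (n - m) * real m powr \<alpha> \<le> real (vertex_count f n)" and
    total: "\<And>n. n0 \<le> n \<Longrightarrow> real (vertex_count f n) \<le> D * real n powr (\<alpha> + 1)" and
    low: "\<And>n. n0 \<le> n \<Longrightarrow> d * real n powr (\<alpha> + 1) \<le> real (vertex_count f n)"
    by (rule vertex_count_growth[OF _ f]) (use \<alpha> in auto)
  \<comment> \<open>\<open>e\<close> is the constant in the number \<open>e k n\<^sup>\<alpha>\<close> of vertices added in the window, which lies beyond \<open>n / 2\<close>;
    \<open>\<delta>\<close> makes the fire of the window at most half of that.\<close>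
  define e where "e = c / 2 powr \<alpha>"
  have "e > 0" using pos by (simp add: e_def)
  define \<delta> where "\<delta> = min (1 / 2) (e / 4)"
  have \<delta>: "\<delta> > 0" "\<delta> \<le> 1 / 2" "2 * \<delta> \<le> e / 2" using \<open>e > 0\<close> by (auto simp: \<delta>_def)
  define \<eta> where "\<eta> = e * \<delta> / (4 * D)"
  have "\<eta> > 0" using pos \<open>e > 0\<close> \<delta> by (simp add: \<eta>_def)
  have "burning_ratio G s n \<le> 1 - \<eta>" if n: "n \<ge> 2 * n0 + 2" "n \<ge> nat \<lceil>2 / \<delta>\<rceil>" for n
  proof -
    have "2 / \<delta> \<le> real n" using n(2) by linarith
    then have "2 \<le> \<delta> * real n" using \<delta> by (simp add: field_simps)
    define k where "k = nat \<lfloor>\<delta> * real n\<rfloor>"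
    have k: "real k \<le> \<delta> * real n" "\<delta> * real n / 2 \<le> real k" "1 \<le> k"
      using \<open>2 \<le> \<delta> * real n\<close> unfolding k_def by linarith+
    have "\<delta> * real n \<le> real n / 2" using mult_right_mono[OF \<delta>(2), of "real n"] by simp
    then have k2: "real k \<le> real n / 2" using k by linarith
    define m where "m = n - k"
    have m: "n0 \<le> m" "m \<le> n" "n - m = k" "real n / 2 \<le> real m"
      using k2 n unfolding m_def by linarith+
    have "real (card (burning G s n)) \<le> real (vertex_count f m + k + k\<^sup>2)"
      using card_burning_path_le[OF G monoI[OF vertex_count_mono] legal m(2)] m(3)
      by (metis of_nat_mono)
    also have "\<dots> \<le> real (vertex_count f m) + 2 * (real k)\<^sup>2"
      using k(3) by (simp add: power2_eq_square)
    also have "(real k)\<^sup>2 \<le> real k * (\<delta> * real n powr \<alpha>)"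
    proof -
      have "real n powr 1 \<le> real n powr \<alpha>" using \<alpha> n by (intro powr_mono) auto
      then have "real k \<le> \<delta> * real n powr \<alpha>"
        using k(1) \<delta>(1) n by (auto intro: order_trans mult_left_mono)
      then show ?thesis unfolding power2_eq_square by (intro mult_left_mono) auto
    qed
    also have "real (vertex_count f m) \<le> real (vertex_count f n) - e * real k * real n powr \<alpha>"
    proof -
      have "e * real k * real n powr \<alpha> = c * real k * (real n / 2) powr \<alpha>"
        by (simp add: e_def powr_divide)
      also have "\<dots> \<le> c * real k * real m powr \<alpha>"
        using pos m \<alpha> by (intro mult_left_mono powr_mono2) auto
      finally show ?thesis using lower[OF m(1,2)] m(3) by simp
    qed
    finally have "real (card (burning G s n)) \<le>
        real (vertex_count f n) - (e - 2 * \<delta>) * (real k * real n powr \<alpha>)"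
      by (simp add: algebra_simps)
    moreover have "(e / 2) * (\<delta> * real n / 2 * real n powr \<alpha>) \<le> (e - 2 * \<delta>) * (real k * real n powr \<alpha>)"
      using \<delta> k \<open>e > 0\<close> by (intro mult_mono mult_right_mono) auto
    moreover have "(e / 2) * (\<delta> * real n / 2 * real n powr \<alpha>) = \<eta> * (D * real n powr (\<alpha> + 1))"
      using pos n by (simp add: \<eta>_def powr_add)
    moreover have "\<eta> * real (vertex_count f n) \<le> \<eta> * (D * real n powr (\<alpha> + 1))"
      using total[of n] \<open>\<eta> > 0\<close> n by (intro mult_left_mono) auto
    ultimately have "real (card (burning G s n)) \<le> (1 - \<eta>) * real (vertex_count f n)"
      by (simp add: algebra_simps)
    moreover have "0 < real (vertex_count f n)"
    proof -
      have "0 < d * real n powr (\<alpha> + 1)" using pos n by simp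
      then show ?thesis using low[of n] n by linarith
    qed
    ultimately show ?thesis
      by (simp add: burning_ratio_def G divide_le_eq)
  qed
  then have "\<forall>\<^sub>F n in sequentially. ereal (burning_ratio G s n) \<le> ereal (1 - \<eta>)"
    unfolding eventually_sequentially
    by (intro exI[of _ "max (2 * n0 + 2) (nat \<lceil>2 / \<delta>\<rceil>)"]) auto
  then have "upper_burning_density G s \<le> ereal (1 - \<eta>)"
    unfolding upper_burning_density_def by (rule Limsup_bounded)
  also have "\<dots> < 1" using \<open>\<eta> > 0\<close> by (simp add: one_ereal_def)
  finally show ?thesis unfolding builder_wins_def .
qed

text \<open>Builder's strategy ignores Arsonist's moves; the length of the history tells the number of the turn.\<close>
theorem builder_has_winning_strategy_superlinear:
  fixes \<alpha> :: real and f :: "nat \<Rightarrow> nat"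
  assumes "\<alpha> \<ge> 1" and "(\<lambda>n. real (f n)) \<in> \<Theta>(\<lambda>n. real n powr \<alpha>)"
  shows "builder_has_winning_strategy f"
  unfolding builder_has_winning_strategy_def
proof (intro exI allI impI)
  fix G s
  assume *: "G 0 = empty_vgraph \<and>
      follows_builder (\<lambda>h. path_graph (vertex_count f (Suc (length h)))) G s \<and> arsonist_legal G s"
  have G: "G n = path_graph (vertex_count f n)" for n
    using * by (cases n) (simp_all add: follows_builder_def history_def empty_vgraph_def path_graph_def del: upt_Suc)
  have "builder_legal f G"
    unfolding builder_legal_def
  proof
    fix n
    show "builder_move (f (Suc n)) (G n) (G (Suc n))"
      using builder_move_path_graph[OF vertex_count_mono[of n "Suc n" f]] by (simp add: G)
  qed
  moreover have "builder_wins G s"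
    using builder_wins_on_paths[OF assms G] * by blast
  ultimately show "builder_legal f G \<and> builder_wins G s" ..
qed

section \<open>Neighbourhoods in a graph\<close>

text \<open>The pairs at distance at most \<open>k\<close>. The reflexive closure lets shorter walks count, and as a power of a
  relation the balls can be composed and turned into iterated spreading of the fire.\<close>
definition nearby :: "'a pair_pre_digraph \<Rightarrow> nat \<Rightarrow> 'a rel" where
  "nearby G k = ((parcs G)\<^sup>=) ^^ k"

lemma nearby_0 [simp]: "nearby G 0 = Id"
  by (simp add: nearby_def)

lemma nearby_Suc: "nearby G (Suc k) = nearby G k O (parcs G)\<^sup>="
  by (simp add: nearby_def)

lemma nearby_add: "nearby G (k + l) = nearby G k O nearby G l"
  by (simp add: nearby_def relpow_add)

lemma nearby_refl: "(v, v) \<in> nearby G k"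
  by (induction k) (auto simp: nearby_Suc)

lemma subset_nearby_Image: "B \<subseteq> nearby G k `` B"
  by (rule subsetI) (rule ImageI[OF nearby_refl])

lemma nearby_mono_steps: "k \<le> l \<Longrightarrow> nearby G k \<subseteq> nearby G l"
  by (induction rule: dec_induct) (auto simp: nearby_Suc)

lemma nearby_mono_graph:
  assumes "parcs G \<subseteq> parcs H"
  shows "nearby G k \<subseteq> nearby H k"
proof (induction k)
  case (Suc k)
  then show ?case using assms unfolding nearby_Suc by (intro relcomp_mono) auto
qed simp

lemma (in pair_sym_digraph) sym_nearby: "(u, v) \<in> nearby G k \<Longrightarrow> (v, u) \<in> nearby G k"
proof (induction k arbitrary: v)
  case (Suc k)
  then obtain w where "(u, w) \<in> nearby G k" "(w, v) \<in> (parcs G)\<^sup>="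
    by (auto simp: nearby_Suc)
  then have "(v, w) \<in> nearby G 1" "(w, u) \<in> nearby G k"
    using Suc.IH arcs_symmetric by (auto simp: nearby_def)
  then show ?case using nearby_add[of G 1 k] by auto
qed simp

lemma (in pair_wf_digraph) nearby_in_pverts:
  "(u, v) \<in> nearby G k \<Longrightarrow> u \<in> pverts G \<Longrightarrow> v \<in> pverts G"
  by (induction k arbitrary: v) (auto simp: nearby_Suc dest: in_arcsD2)

lemma spread_eq_nearby:
  assumes "pair_wf_digraph G"
  shows "spread G B = B \<union> nearby G 1 `` B"
  using pair_wf_digraph.in_arcsD2[OF assms] by (auto simp: spread_def nearby_def)

text \<open>By connectedness every ball that is not yet the whole graph gains at least one vertex when its radius
  grows by one.\<close>
lemma (in pair_graph) card_ball_ge: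
  assumes conn: "Digraph_Component.connected (with_proj G)" and v: "v \<in> pverts G"
    and "nearby G k `` {v} \<noteq> pverts G"
  shows "k + 1 \<le> card (nearby G k `` {v})"
  using assms(3)
proof (induction k)
  case (Suc k)
  let ?S = "nearby G k `` {v}" and ?T = "nearby G (Suc k) `` {v}"
  have sub: "?S \<subseteq> ?T" "?T \<subseteq> pverts G"
    using nearby_mono_steps[of k "Suc k" G] nearby_in_pverts v by auto
  with Suc.prems obtain w where w: "w \<in> pverts G" "w \<notin> ?T" by blast
  have "v \<rightarrow>\<^sup>*\<^bsub>with_proj G\<^esub> w"
    using conn v w(1) reachable_mk_symmetric_eq[OF pair_sym_arcs]
    unfolding connected_def strongly_connected_def by simp
  moreover have "w \<notin> ?S" using w sub by blast
  moreover have "v \<in> ?S" by (simp add: nearby_refl)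
  ultimately obtain x y where "x \<in> ?S" "y \<notin> ?S" "(x, y) \<in> parcs G"
    unfolding reachable_def by (induction rule: rtrancl_on_induct) auto
  then have "y \<in> ?T - ?S" by (auto simp: nearby_Suc)
  with sub have "?S \<subset> ?T" by blast
  then have "card ?S < card ?T"
    using sub(2) pair_finite_verts by (intro psubset_card_mono finite_subset[OF sub(2)])
  moreover have "k + 1 \<le> card ?S" using Suc.IH w sub by blast
  ultimately show ?case by simp
qed auto

section \<open>Arsonist lights the vertex farthest from the fire\<close>

text \<open>\<open>v\<close> has the largest distance from \<open>B\<close>, expressed without naming the distance: a radius that suffices for
  \<open>v\<close> suffices for all vertices. This also covers vertices that \<open>B\<close> does not reach, in particular the case
  \<open>B = {}\<close>.\<close>
definition farthest :: "'a pair_pre_digraph \<Rightarrow> 'a set \<Rightarrow> 'a \<Rightarrow> bool" where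
  "farthest G B v \<longleftrightarrow> v \<in> pverts G - B \<and>
     (\<forall>k. v \<in> nearby G k `` B \<longrightarrow> pverts G \<subseteq> nearby G k `` B)"

lemma ex_farthest:
  assumes "finite (pverts G)" "\<not> pverts G \<subseteq> B"
  shows "\<exists>v. farthest G B v"
proof -
  \<comment> \<open>The times at which a spreading fire has reached a vertex form an up-closed set of naturals. Such sets are
    linearly ordered by inclusion, so a minimal one is the least: it belongs to a farthest vertex.\<close>
  define times where "times v = {k. v \<in> nearby G k `` B}" for v
  have "finite (times ` (pverts G - B))" "times ` (pverts G - B) \<noteq> {}" using assms by auto
  from finite_has_minimal[OF this] obtain v where v: "v \<in> pverts G - B"
    and min: "\<And>w. w \<in> pverts G - B \<Longrightarrow> times w \<subseteq> times v \<Longrightarrow> times w = times v"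
    by auto
  have up: "l \<in> times w" if "k \<in> times w" "k \<le> l" for k l w
    using that nearby_mono_steps[of k l G] by (auto simp: times_def)
  have chain: "times w \<subseteq> times v \<or> times v \<subseteq> times w" for w
    using up by (meson nat_le_linear subsetI)
  have "times v \<subseteq> times w" if "w \<in> pverts G - B" for w
    using min[OF that] chain[of w] by auto
  moreover have "times w = UNIV" if "w \<in> B" for w
    using that subset_nearby_Image[of B G] by (auto simp: times_def)
  ultimately have "times v \<subseteq> times w" if "w \<in> pverts G" for w
    using that by blast
  with v have "farthest G B v" unfolding farthest_def times_def by blast
  then show ?thesis ..
qed

definition farthest_move :: "'a pair_pre_digraph \<Rightarrow> 'a set \<Rightarrow> 'a option" where
  "farthest_move G B = (if pverts G \<subseteq> B then None else Some (SOME v. farthest G B v))"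

lemma farthest_farthest_move:
  assumes "finite (pverts G)" and v: "farthest_move G B = Some v"
  shows "farthest G B v"
proof -
  have "\<not> pverts G \<subseteq> B" "v = (SOME v. farthest G B v)"
    using v by (auto simp: farthest_move_def split: if_splits)
  then show ?thesis
    using ex_farthest[OF assms(1)] by (metis someI_ex)
qed

lemma arsonist_move_farthest_move:
  assumes "finite (pverts G)"
  shows "arsonist_move G B (farthest_move G B)"
proof (cases "farthest_move G B")
  case None
  then show ?thesis by (simp add: arsonist_move_def farthest_move_def split: if_splits)
next
  case (Some v)
  then show ?thesis
    using farthest_farthest_move[OF assms Some] by (simp add: arsonist_move_def farthest_def)
qed

text \<open>A strategy sees the history of moves, from which it has to recompute the fire.\<close>
definition burning_of :: "history \<Rightarrow> nat set" where
  "burning_of h = fold (\<lambda>(G, s) B. spread G B \<union> set_option s) h {}"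

lemma burning_of_history: "burning_of (history G s n) = burning G s n"
  by (induction n) (simp_all add: history_def burning_of_def)

locale farthest_play =
  fixes f :: "nat \<Rightarrow> nat" and G :: "nat \<Rightarrow> vgraph" and s :: "nat \<Rightarrow> nat option"
  assumes start: "G 0 = empty_vgraph"
    and builder_legal: "builder_legal f G"
    and farthest_moves: "\<And>n. s (Suc n) = farthest_move (G (Suc n)) (spread (G (Suc n)) (burning G s n))"
begin

lemma move: "builder_move (f (Suc n)) (G n) (G (Suc n))"
  using builder_legal by (simp add: builder_legal_def)

lemma pair_graph: "pair_graph (G n)"
proof (cases n)
  case 0
  show ?thesis unfolding 0 start
    by unfold_locales (auto simp: empty_vgraph_def symmetric_def)
qed (use move in \<open>simp add: builder_move_def\<close>)

sublocale pair_graph "G n" for n by (rule pair_graph)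

lemma pverts_mono: "m \<le> n \<Longrightarrow> pverts (G m) \<subseteq> pverts (G n)"
  by (rule lift_Suc_mono_le) (use move in \<open>simp add: builder_move_def\<close>)

lemma parcs_mono: "m \<le> n \<Longrightarrow> parcs (G m) \<subseteq> parcs (G n)"
  by (rule lift_Suc_mono_le) (use move in \<open>simp add: builder_move_def\<close>)

lemma card_pverts: "card (pverts (G n)) = vertex_count f n"
proof (induction n)
  case 0
  then show ?case by (simp add: start empty_vgraph_def)
next
  case (Suc n)
  have "card (pverts (G (Suc n)) - pverts (G n)) = f (Suc n)"
    using move[of n] by (simp add: builder_move_def)
  moreover have "card (pverts (G n)) \<le> card (pverts (G (Suc n)))"
    by (intro card_mono pair_finite_verts pverts_mono) simp
  ultimately show ?case
    using Suc card_Diff_subset[OF pair_finite_verts[of n] pverts_mono[of n "Suc n"]] by simp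
qed

lemma arsonist_legal: "arsonist_legal G s"
  using arsonist_move_farthest_move pair_finite_verts by (simp add: arsonist_legal_def farthest_moves)

lemma burning_subset: "burning G s n \<subseteq> pverts (G n)"
  using burning_subset_pverts[OF arsonist_legal] pverts_mono by simp

lemma burning_mono: "m \<le> n \<Longrightarrow> burning G s m \<subseteq> burning G s n"
  by (induction rule: dec_induct) (auto simp: spread_def)

lemma burning_nonempty: "pverts (G n) \<noteq> {} \<Longrightarrow> burning G s n \<noteq> {}"
  by (cases n) (auto simp: start empty_vgraph_def farthest_moves farthest_move_def split: if_splits)

text \<open>The vertices burning when Arsonist chooses the source of turn \<open>n\<close>.\<close>
definition fire :: "nat \<Rightarrow> nat set" where
  "fire n = spread (G n) (burning G s (n - 1))"

lemma burning_eq_fire: "0 < n \<Longrightarrow> burning G s n = fire n \<union> set_option (s n)"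
  by (cases n) (auto simp: fire_def)

lemma burning_before_subset_fire: "j < i \<Longrightarrow> burning G s j \<subseteq> fire i"
  using burning_mono[of j "i - 1"] by (fastforce simp: fire_def spread_def)

lemma fire_subset: "0 < n \<Longrightarrow> fire n \<subseteq> pverts (G n)"
  using burning_eq_fire[of n] burning_subset[of n] by auto

text \<open>The fire spreads along the edges of the old graph \<open>G n\<close> as fast in the later graphs, which contain it.\<close>
lemma nearby_fire_burning: "0 < n \<Longrightarrow> nearby (G n) q `` fire n \<subseteq> burning G s (n + q)"
proof (induction q)
  case 0
  then show ?case by (auto simp: burning_eq_fire)
next
  case (Suc q)
  have "nearby (G n) (Suc q) `` fire n \<subseteq> (parcs (G n))\<^sup>= `` burning G s (n + q)"
    using Suc by (auto simp: nearby_Suc)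
  also have "\<dots> \<subseteq> (parcs (G (Suc (n + q))))\<^sup>= `` burning G s (n + q)"
    using parcs_mono[of n "Suc (n + q)"] by auto
  also have "\<dots> \<subseteq> spread (G (Suc (n + q))) (burning G s (n + q))"
    by (auto simp: spread_eq_nearby pair_wf_digraph_axioms nearby_def)
  finally show ?case by auto
qed

text \<open>Suppose that in each of \<open>m\<close> consecutive turns some vertex is farther than \<open>2 * r\<close> from the fire; then so is the
  source lit in that turn. The balls of radius \<open>r\<close> around these sources, each taken in the graph of its own
  turn, are pairwise disjoint: the later source is measured in the later graph, where the earlier ball can only
  have grown and where the earlier source is part of the fire. Each ball has more than \<open>r\<close> vertices, so there
  would be at least \<open>m * (r + 1)\<close> vertices.\<close>
lemma exists_turn_near_fire:
  assumes "pverts (G n) \<noteq> {}" and count: "vertex_count f (n + m) < m * (r + 1)"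
  shows "\<exists>i\<in>{n<..n + m}. pverts (G i) \<subseteq> nearby (G i) (2 * r) `` fire i"
proof (rule ccontr)
  assume "\<not> ?thesis"
  then have far: "\<not> pverts (G i) \<subseteq> nearby (G i) (2 * r) `` fire i" if "i \<in> {n<..n + m}" for i
    using that by blast
  have "\<exists>v. s i = Some v \<and> v \<in> pverts (G i) \<and> v \<notin> nearby (G i) (2 * r) `` fire i"
    if i: "i \<in> {n<..n + m}" for i
  proof -
    obtain i' where i': "i = Suc i'" using i by (cases i) auto
    have "\<not> pverts (G i) \<subseteq> fire i" using far[OF i] subset_nearby_Image by (metis order_trans)
    then obtain v where v: "s i = Some v"
      using farthest_moves[of i'] by (auto simp: i' fire_def farthest_move_def)
    have "s i = farthest_move (G i) (fire i)" using farthest_moves[of i'] by (simp add: i' fire_def)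
    then have "farthest (G i) (fire i) v"
      using v farthest_farthest_move pair_finite_verts by metis
    with v far[OF i] show ?thesis by (auto simp: farthest_def)
  qed
  then obtain v where v: "\<And>i. i \<in> {n<..n + m} \<Longrightarrow>
      s i = Some (v i) \<and> v i \<in> pverts (G i) \<and> v i \<notin> nearby (G i) (2 * r) `` fire i"
    by metis
  define ball where "ball i = nearby (G i) r `` {v i}" for i
  have ball_subset: "ball i \<subseteq> pverts (G i)" if "i \<in> {n<..n + m}" for i
    using v[OF that] nearby_in_pverts by (auto simp: ball_def)
  have ball_large: "r + 1 \<le> card (ball i)" if i: "i \<in> {n<..n + m}" for i
    unfolding ball_def
  proof (rule card_ball_ge)
    show "v i \<in> pverts (G i)" using v[OF i] by simp
    obtain i' where i': "i = Suc i'" using i by (cases i) auto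
    show "connected (with_proj (G i))"
      using move[of i'] v[OF i] by (auto simp: builder_move_def i')
    obtain b where b: "b \<in> fire i"
      using burning_nonempty[OF assms(1)] burning_before_subset_fire[of n i] i by auto
    then have "b \<in> pverts (G i)" using fire_subset[of i] i by auto
    moreover have "b \<notin> nearby (G i) r `` {v i}"
    proof
      assume "b \<in> nearby (G i) r `` {v i}"
      then have "(b, v i) \<in> nearby (G i) r" using sym_nearby by blast
      then have "(b, v i) \<in> nearby (G i) (2 * r)" using nearby_mono_steps[of r "2 * r" "G i"] by auto
      then show False using v[OF i] b by blast
    qed
    ultimately show "nearby (G i) r `` {v i} \<noteq> pverts (G i)" by blast
  qed
  have disjoint: "ball j \<inter> ball i = {}" if "j \<in> {n<..n + m}" "i \<in> {n<..n + m}" "j < i" for i j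
  proof (rule ccontr)
    assume "ball j \<inter> ball i \<noteq> {}"
    then obtain w where "(v j, w) \<in> nearby (G j) r" "(v i, w) \<in> nearby (G i) r"
      by (auto simp: ball_def)
    then have "(v j, w) \<in> nearby (G i) r" "(w, v i) \<in> nearby (G i) r"
      using nearby_mono_graph[OF parcs_mono, of j i r] \<open>j < i\<close> sym_nearby by auto
    then have "(v j, v i) \<in> nearby (G i) (2 * r)"
      unfolding mult_2 nearby_add by blast
    moreover have "v j \<in> fire i"
      using burning_before_subset_fire[OF \<open>j < i\<close>] burning_eq_fire[of j] v[OF that(1)] that(1) by auto
    ultimately show False using v[OF that(2)] by blast
  qed
  have "m * (r + 1) = (\<Sum>i\<in>{n<..n + m}. r + 1)" by simp
  also have "\<dots> \<le> (\<Sum>i\<in>{n<..n + m}. card (ball i))"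
    by (intro sum_mono ball_large)
  also have "\<dots> = card (\<Union>i\<in>{n<..n + m}. ball i)"
  proof (rule card_UN_disjoint[symmetric])
    show "\<forall>i\<in>{n<..n + m}. finite (ball i)"
      using ball_subset pair_finite_verts finite_subset by blast
    show "\<forall>i\<in>{n<..n + m}. \<forall>j\<in>{n<..n + m}. i \<noteq> j \<longrightarrow> ball i \<inter> ball j = {}"
      using disjoint by (metis inf_commute nat_neq_iff)
  qed simp
  also have "\<dots> \<le> card (pverts (G (n + m)))"
  proof (intro card_mono pair_finite_verts UN_least)
    fix i assume "i \<in> {n<..n + m}"
    then show "ball i \<subseteq> pverts (G (n + m))" using ball_subset[of i] pverts_mono[of i "n + m"] by auto
  qed
  finally show False using count by (simp add: card_pverts)
qed

text \<open>At the turn found above all vertices are within \<open>2 * r\<close> of the fire, and \<open>2 * r\<close> turns later they burn.\<close>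
lemma all_old_vertices_burning:
  assumes "pverts (G n) \<noteq> {}" "vertex_count f (n + m) < m * (r + 1)"
  shows "pverts (G n) \<subseteq> burning G s (n + m + 2 * r)"
proof -
  obtain i where i: "n < i" "i \<le> n + m" "pverts (G i) \<subseteq> nearby (G i) (2 * r) `` fire i"
    using exists_turn_near_fire[OF assms] by auto
  have "pverts (G n) \<subseteq> pverts (G i)" using i by (intro pverts_mono) simp
  also have "\<dots> \<subseteq> burning G s (i + 2 * r)"
    using i nearby_fire_burning[of i "2 * r"] by simp
  also have "\<dots> \<subseteq> burning G s (n + m + 2 * r)" using i by (intro burning_mono) simp
  finally show ?thesis .
qed

text \<open>The choice \<open>r = m\<close> balances the number of turns spent on covering the graph by balls against the time
  the fire needs to fill the balls.\<close>
lemma burning_ratio_ge: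
  assumes "3 * m \<le> p" "0 < vertex_count f (p - 3 * m)" "vertex_count f p < m\<^sup>2"
  shows "real (vertex_count f (p - 3 * m)) / real (vertex_count f p) \<le> burning_ratio G s p"
proof -
  let ?n = "p - 3 * m"
  have "vertex_count f (?n + m) < m * (m + 1)"
    using assms vertex_count_mono[of "?n + m" p f] by (simp add: power2_eq_square)
  moreover have "pverts (G ?n) \<noteq> {}" using assms(2) card_pverts[of ?n] by auto
  ultimately have "pverts (G ?n) \<subseteq> burning G s (?n + m + 2 * m)"
    by (rule all_old_vertices_burning[rotated])
  then have "pverts (G ?n) \<subseteq> burning G s p" using assms(1) by simp
  then have "vertex_count f ?n \<le> card (burning G s p)"
    using card_mono[OF finite_subset[OF burning_subset pair_finite_verts]] card_pverts by metis
  then show ?thesis by (simp add: burning_ratio_def card_pverts divide_right_mono)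
qed

lemma burning_ratio_le_1: "burning_ratio G s p \<le> 1"
  using card_mono[OF pair_finite_verts burning_subset, of p]
  by (auto simp: burning_ratio_def divide_le_eq)

text \<open>For \<open>m\<close> of order \<open>p\<^sup>\<beta>\<close> with \<open>(\<alpha> + 1) / 2 < \<beta> < 1\<close> the square \<open>m\<^sup>2\<close> exceeds the number of vertices, of order
  \<open>p\<^sup>\<alpha>\<^sup>+\<^sup>1\<close>, so at time \<open>p\<close> all vertices burn except those of the last \<open>3 * m\<close> turns. Since \<open>m\<close> is small compared
  with \<open>p\<close>, these are a vanishing fraction. It is here that \<open>\<alpha> < 1\<close> is used: it leaves room for such a \<open>\<beta>\<close>.\<close>
lemma arsonist_wins:
  fixes \<alpha> :: real
  assumes \<alpha>: "0 < \<alpha>" "\<alpha> < 1" and f: "(\<lambda>n. real (f n)) \<in> \<Theta>(\<lambda>n. real n powr \<alpha>)"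
  shows "arsonist_wins G s"
proof -
  obtain c C d D n0 where pos: "c > 0" "C > 0" "d > 0" "D > 0" and
    "\<And>m n. n0 \<le> m \<Longrightarrow> m \<le> n \<Longrightarrow>
       real (vertex_count f m) + c * real (n - m) * real m powr \<alpha> \<le> real (vertex_count f n)" and
    upper: "\<And>m n. n0 \<le> m \<Longrightarrow> m \<le> n \<Longrightarrow>
       real (vertex_count f n) \<le> real (vertex_count f m) + C * real (n - m) * real n powr \<alpha>" and
    low: "\<And>n. n0 \<le> n \<Longrightarrow> d * real n powr (\<alpha> + 1) \<le> real (vertex_count f n)" and
    total: "\<And>n. n0 \<le> n \<Longrightarrow> real (vertex_count f n) \<le> D * real n powr (\<alpha> + 1)"
    by (rule vertex_count_growth[OF \<alpha>(1) f]) (rule that)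
  \<comment> \<open>The midpoint between \<open>(\<alpha> + 1) / 2\<close> and \<open>1\<close>.\<close>
  define \<beta> where "\<beta> = (\<alpha> + 3) / 4"
  have \<beta>: "\<beta> < 1" "\<alpha> + 1 < 2 * \<beta>" "0 < \<beta>" using \<alpha> by (auto simp: \<beta>_def)
  define m where "m p = nat \<lceil>real p powr \<beta>\<rceil>" for p :: nat
  have m_ge: "real p powr \<beta> \<le> real (m p)" for p by (simp add: m_def of_nat_ceiling)
  have m_le: "real (m p) \<le> real p powr \<beta> + 1" for p unfolding m_def
    by (smt (verit) of_nat_nat ceiling_correct powr_ge_zero zero_le_ceiling)
  have "\<forall>\<^sub>F p in sequentially. 3 * (real p powr \<beta> + 1) \<le> real p / 2"
    using \<beta> by real_asymp
  moreover have "\<forall>\<^sub>F p in sequentially. D * real p powr (\<alpha> + 1) < real p powr (2 * \<beta>)"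
    using \<beta> pos \<alpha> by real_asymp
  moreover have "\<forall>\<^sub>F p in sequentially. 2 * n0 + 2 \<le> p"
    by (rule eventually_ge_at_top)
  ultimately have lower: "\<forall>\<^sub>F p in sequentially.
      1 - 3 * C / d * ((real p powr \<beta> + 1) / real p) \<le> burning_ratio G s p"
  proof eventually_elim
    case (elim p)
    have "real (3 * m p) \<le> real p / 2" using elim(1) m_le[of p] by simp
    then have mp: "3 * m p \<le> p" "n0 \<le> p - 3 * m p" "0 < p - 3 * m p" "n0 \<le> p" "0 < p"
      using elim(3) by linarith+
    have N: "0 < real (vertex_count f n)" if "n0 \<le> n" "0 < n" for n
    proof -
      have "0 < d * real n powr (\<alpha> + 1)" using pos that by simp
      then show ?thesis using low[of n] that by linarith
    qed
    have "real (vertex_count f p) < real p powr (2 * \<beta>)"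
      using total[of p] elim(2) mp by linarith
    also have "\<dots> = (real p powr \<beta>)\<^sup>2" by (simp add: power2_eq_square flip: powr_add)
    also have "\<dots> \<le> (real (m p))\<^sup>2" using m_ge by (intro power_mono) auto
    finally have "vertex_count f p < (m p)\<^sup>2"
      by (metis of_nat_less_iff of_nat_power)
    then have "real (vertex_count f (p - 3 * m p)) / real (vertex_count f p) \<le> burning_ratio G s p"
      using mp N by (intro burning_ratio_ge) auto
    moreover have "1 - 3 * C / d * ((real p powr \<beta> + 1) / real p) \<le>
        real (vertex_count f (p - 3 * m p)) / real (vertex_count f p)"
    proof -
      have "real (vertex_count f p) - real (vertex_count f (p - 3 * m p))
          \<le> 3 * C * (real (m p) * real p powr \<alpha>)"
        using upper[of "p - 3 * m p" p] mp by simp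
      also have "\<dots> \<le> 3 * C * ((real p powr \<beta> + 1) * real p powr \<alpha>)"
        using m_le pos by (intro mult_left_mono mult_right_mono) auto
      also have "\<dots> = 3 * C / d * ((real p powr \<beta> + 1) / real p) * (d * real p powr (\<alpha> + 1))"
        using pos mp by (simp add: powr_add)
      also have "\<dots> \<le> 3 * C / d * ((real p powr \<beta> + 1) / real p) * real (vertex_count f p)"
        using low[of p] mp pos by (intro mult_left_mono) auto
      finally show ?thesis using N[of p] mp by (simp add: field_simps)
    qed
    ultimately show ?case by linarith
  qed
  have limit: "(\<lambda>p. 1 - 3 * C / d * ((real p powr \<beta> + 1) / real p)) \<longlonglongrightarrow> 1"
    using \<beta> by real_asymp
  have "burning_ratio G s \<longlonglongrightarrow> 1"
    by (rule tendsto_sandwich[OF lower _ limit tendsto_const])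
      (simp add: burning_ratio_le_1)
  then show ?thesis by (simp add: arsonist_wins_def)
qed

end

theorem arsonist_has_winning_strategy_sublinear:
  fixes \<alpha> :: real and f :: "nat \<Rightarrow> nat"
  assumes "0 < \<alpha>" "\<alpha> < 1" and "(\<lambda>n. real (f n)) \<in> \<Theta>(\<lambda>n. real n powr \<alpha>)"
  shows "arsonist_has_winning_strategy f"
  unfolding arsonist_has_winning_strategy_def
proof (intro exI allI impI)
  fix G s
  assume *: "G 0 = empty_vgraph \<and> builder_legal f G \<and>
      follows_arsonist (\<lambda>h H. farthest_move H (spread H (burning_of h))) G s"
  interpret farthest_play f G s
    using * by unfold_locales (simp_all add: follows_arsonist_def burning_of_history )
  show "arsonist_legal G s \<and> arsonist_wins G s"
    using arsonist_legal arsonist_wins[OF assms] ..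
qed

theorem theorem1:
  fixes \<alpha> :: real and f :: "nat \<Rightarrow> nat"
  assumes "\<alpha> > 0"
    and "(\<lambda>n. real (f n)) \<in> \<Theta>(\<lambda>n. real n powr \<alpha>)"
  shows "(\<alpha> < 1 \<longrightarrow> arsonist_has_winning_strategy f) \<and>
         (\<alpha> \<ge> 1 \<longrightarrow> builder_has_winning_strategy f)"
proof (intro conjI impI)
  show "arsonist_has_winning_strategy f" if "\<alpha> < 1"
    using assms(1) that assms(2) by (rule arsonist_has_winning_strategy_sublinear)
  show "builder_has_winning_strategy f" if "\<alpha> \<ge> 1"
    using that assms(2) by (rule builder_has_winning_strategy_superlinear)
qed

end
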